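(* Let $m,b$ be positive integers. No deterministic first-stage algorithm for sand has robustness factor smaller than $$\overline{\rho}(m,b)=\frac{m^b}{m^b-(m-1)^b}=\frac{1}{1-\left(1-\frac1m\right)^b}.$$ That is, for every choice of bag sizes $a_1,\dots,a_b\ge 0$ with $\sum_j a_j=P$, there exist speeds $s_1,\dots,s_m$ such that every assignment of the bags to the machines has makespan at least $\overline{\rho}(m,b)\,C^*_{\max}$.
   Context: Speed-robust scheduling of sand (infinitesimally small jobs): In the first stage, the algorithm receives only positive integers $m$ (number of machines), $b$ (number of bags) and a real $P>0$ (total processing volume), and outputs non-negative reals $a_1,\dots,a_b$ (bag sizes) with $\sum_j a_j=P$. In the second stage, speeds $s_1,\dots,s_m\ge0$ (not all zero) are revealed and each bag is assigned as a whole to a machine (a speed-$0$ machine receives no bags); machine $i$ with bag set $M_i$ has completion time $(\sum_{j\in M_i}a_j)/s_i$ (or $0$ if $s_i=0$), and the makespan $C_{\max}$ is the maximum completion time. The optimal (adversary's) makespan is $C^*_{\max}=P/\sum_{i=1}^m s_i$. The algorithm is $\rho$-robust if for every $P$ and every choice of speeds there is an assignment of bags with $C_{\max}\le\rho\,C^*_{\max}$; its robustness factor is the smallest such $\rho$. *)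

theory Defs
  imports Complex_Main "HOL-Library.FuncSet"
begin

definition bag_sizes :: "nat \<Rightarrow> real \<Rightarrow> (nat \<Rightarrow> real) set" where
  "bag_sizes b P = {a. (\<forall>j\<in>{1..b}. a j \<ge> 0) \<and> (\<Sum>j=1..b. a j) = P}"

definition speeds :: "nat \<Rightarrow> (nat \<Rightarrow> real) set" where
  "speeds m = {s. (\<forall>i\<in>{1..m}. s i \<ge> 0) \<and> (\<exists>i\<in>{1..m}. s i \<noteq> 0)}"

text \<open>Assignments are extensional functions from bags to machines. No bag, not even
  one of size zero, may be put on a machine of speed zero.\<close>

definition assignments :: "nat \<Rightarrow> nat \<Rightarrow> (nat \<Rightarrow> real) \<Rightarrow> (nat \<Rightarrow> nat) set" where
  "assignments m b s = {f \<in> {1..b} \<rightarrow>\<^sub>E {1..m}. \<forall>j\<in>{1..b}. s (f j) \<noteq> 0}"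

definition completion_time ::
    "nat \<Rightarrow> (nat \<Rightarrow> real) \<Rightarrow> (nat \<Rightarrow> real) \<Rightarrow> (nat \<Rightarrow> nat) \<Rightarrow> nat \<Rightarrow> real" where
  "completion_time b a s f i =
     (if s i = 0 then 0 else (\<Sum>j | j \<in> {1..b} \<and> f j = i. a j) / s i)"

definition makespan ::
    "nat \<Rightarrow> nat \<Rightarrow> (nat \<Rightarrow> real) \<Rightarrow> (nat \<Rightarrow> real) \<Rightarrow> (nat \<Rightarrow> nat) \<Rightarrow> real" where
  "makespan m b a s f = Max (completion_time b a s f ` {1..m})"

definition opt_makespan :: "nat \<Rightarrow> real \<Rightarrow> (nat \<Rightarrow> real) \<Rightarrow> real" where
  "opt_makespan m P s = P / (\<Sum>i=1..m. s i)"

text \<open>A deterministic first-stage algorithm is a function of \<open>m\<close>, \<open>b\<close> and \<open>P\<close> alone;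
  its result is the sequence of bag sizes.\<close>

type_synonym first_stage = "nat \<Rightarrow> nat \<Rightarrow> real \<Rightarrow> nat \<Rightarrow> real"

definition first_stage_algorithm :: "first_stage \<Rightarrow> bool" where
  "first_stage_algorithm A \<longleftrightarrow> (\<forall>m b P. m > 0 \<longrightarrow> b > 0 \<longrightarrow> P > 0 \<longrightarrow> A m b P \<in> bag_sizes b P)"

definition robust :: "first_stage \<Rightarrow> nat \<Rightarrow> nat \<Rightarrow> real \<Rightarrow> bool" where
  "robust A m b \<rho> \<longleftrightarrow> (\<forall>P>0. \<forall>s\<in>speeds m. \<exists>f\<in>assignments m b s.
     makespan m b (A m b P) s f \<le> \<rho> * opt_makespan m P s)"

text \<open>The least element exists for every algorithm when \<open>m\<close> and \<open>b\<close> are positive;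
  see \<open>robust_robustness_factor\<close> below.\<close>

definition robustness_factor :: "first_stage \<Rightarrow> nat \<Rightarrow> nat \<Rightarrow> real" where
  "robustness_factor A m b = (LEAST \<rho>. robust A m b \<rho>)"

definition rho_bar :: "nat \<Rightarrow> nat \<Rightarrow> real" where
  "rho_bar m b = real m ^ b / (real m ^ b - (real m - 1) ^ b)"

lemma sum_speeds_pos: "s \<in> speeds m \<Longrightarrow> 0 < (\<Sum>i=1..m. s i)"
  unfolding speeds_def by (smt (verit) finite_atLeastAtMost mem_Collect_eq sum_nonneg sum_nonneg_eq_0_iff)

lemma finite_assignments: "finite (assignments m b s)"
  unfolding assignments_def by (simp add: finite_PiE)

lemma robust_m:
  assumes A: "first_stage_algorithm A" and m: "m > 0" and b: "b > 0"
  shows "robust A m b (real m)"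
  unfolding robust_def
proof (intro allI impI ballI)
  fix P :: real and s assume P: "P > 0" and s: "s \<in> speeds m"
  define M where "M = Max (s ` {1..m})"
  have ne: "finite (s ` {1..m})" "s ` {1..m} \<noteq> {}" using m by auto
  obtain k where k: "k \<in> {1..m}" "s k = M"
    using Max_in[OF ne] unfolding M_def by auto
  have le: "s i \<le> M" if "i \<in> {1..m}" for i
    using that ne unfolding M_def by (intro Max_ge) auto
  have pos: "M > 0" using s le unfolding speeds_def by force
  define f where "f = (\<lambda>j\<in>{1..b}. k)"
  have f: "f \<in> assignments m b s"
    using k pos by (auto simp: assignments_def f_def)
  have sum: "(\<Sum>j=1..b. A m b P j) = P"
    using A m b P by (auto simp: first_stage_algorithm_def bag_sizes_def)
  have S: "0 < (\<Sum>i=1..m. s i)" by (rule sum_speeds_pos[OF s])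
  have "(\<Sum>i=1..m. s i) \<le> real m * M"
    using sum_bounded_above[of "{1..m}" s M] le by auto
  then have R: "P / M \<le> real m * opt_makespan m P s"
    using P pos S by (simp add: opt_makespan_def field_simps)
  have "completion_time b (A m b P) s f i \<le> P / M" if "i \<in> {1..m}" for i
  proof (cases "i = k")
    case True
    then have "{j. j \<in> {1..b} \<and> f j = i} = {1..b}" by (auto simp: f_def)
    then show ?thesis using True k pos sum by (simp add: completion_time_def)
  next
    case False
    then have "{j. j \<in> {1..b} \<and> f j = i} = {}" by (auto simp: f_def)
    then show ?thesis using P pos by (simp only: completion_time_def) simp
  qed
  then have "makespan m b (A m b P) s f \<le> P / M"
    unfolding makespan_def using m by (intro Max.boundedI) auto
  with R f show "\<exists>f\<in>assignments m b s. makespan m b (A m b P) s f \<le> real m * opt_makespan m P s"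
    by force
qed

lemma robust_nonneg:
  assumes A: "first_stage_algorithm A" and m: "m > 0" and b: "b > 0" and r: "robust A m b r"
  shows "r \<ge> 0"
proof -
  define s :: "nat \<Rightarrow> real" where "s = (\<lambda>_. 1)"
  have s: "s \<in> speeds m" using m by (auto simp: speeds_def s_def)
  from r s obtain f where le: "makespan m b (A m b 1) s f \<le> r * opt_makespan m 1 s"
    unfolding robust_def by (meson zero_less_one)
  have a: "\<forall>j\<in>{1..b}. A m b 1 j \<ge> 0"
    using A m b by (auto simp: first_stage_algorithm_def bag_sizes_def)
  have "0 \<le> completion_time b (A m b 1) s f 1"
    using a by (auto simp: completion_time_def s_def intro!: sum_nonneg)
  also have "\<dots> \<le> makespan m b (A m b 1) s f"
    unfolding makespan_def using m by (intro Max_ge) auto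
  finally have "0 \<le> r * opt_makespan m 1 s" using le by linarith
  moreover have "opt_makespan m 1 s > 0" using m by (simp add: opt_makespan_def s_def)
  ultimately show ?thesis by (simp add: zero_le_mult_iff)
qed

lemma robust_robustness_factor:
  assumes A: "first_stage_algorithm A" and m: "m > 0" and b: "b > 0"
  shows "robust A m b (robustness_factor A m b)"
    and "robust A m b r' \<Longrightarrow> robustness_factor A m b \<le> r'"
proof -
  define R where "R = {r. robust A m b r}"
  define r where "r = Inf R"
  have ne: "R \<noteq> {}" using robust_m[OF assms] by (auto simp: R_def)
  have bdd: "bdd_below R" using robust_nonneg[OF assms] by (auto simp: R_def intro!: bdd_belowI)
  have rob: "robust A m b r"
    unfolding robust_def
  proof (intro allI impI ballI, rule ccontr)
    fix P :: real and s assume P: "P > 0" and s: "s \<in> speeds m"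
    define C where "C = opt_makespan m P s"
    have C: "C > 0" using P sum_speeds_pos[OF s] by (simp add: C_def opt_makespan_def)
    define K where "K = makespan m b (A m b P) s ` assignments m b s"
    have K: "\<exists>x\<in>K. x \<le> t * C" if "t \<in> R" for t
      using that P s unfolding R_def robust_def K_def C_def by blast
    have finK: "finite K" "K \<noteq> {}" using finite_assignments K ne by (auto simp: K_def)
    assume "\<not> (\<exists>f\<in>assignments m b s. makespan m b (A m b P) s f \<le> r * opt_makespan m P s)"
    then have "\<forall>x\<in>K. r * C < x" by (auto simp: K_def C_def)
    then have "r * C < Min K" using finK by simp
    then have "r < Min K / C" using C by (simp add: field_simps)
    then obtain t where t: "t \<in> R" "t < Min K / C"
      unfolding r_def using cInf_less_iff[OF ne bdd] by auto
    then have "t * C < Min K" using C by (simp add: field_simps)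
    with K[OF t(1)] finK show False by (meson Min_le leD order_trans)
  qed
  have min: "r \<le> t" if "robust A m b t" for t
    using that bdd unfolding r_def R_def by (intro cInf_lower) auto
  have eq: "robustness_factor A m b = r"
    unfolding robustness_factor_def using rob min by (rule Least_equality)
  show "robust A m b (robustness_factor A m b)" using rob eq by simp
  show "robust A m b r' \<Longrightarrow> robustness_factor A m b \<le> r'" using min eq by simp
qed

end

theory Submission
  imports Defs
begin

text \<open>
  Put \<open>U = rho_bar m b * P\<close> and let all speeds sum to \<open>U\<close>, so that the makespan to beat is \<open>1\<close>.
  For a bag \<open>k\<close>, let \<open>m - 1\<close> machines have speed \<open>a k\<close> and one machine have speed
  \<open>U - (m - 1) * a k\<close>. A makespan below \<open>1\<close> forces every bag at least as large as bag \<open>k\<close> onto the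
  fast machine, which is too much as soon as \<open>(m - 1) * a k + (\<Sum>i | a i \<ge> a k. a i) \<ge> U\<close>.
  If no \<open>k\<close> satisfied this inequality, then collecting the bags from the largest to the smallest,
  each bag would take less than a fraction \<open>1 / m\<close> of what remains of \<open>U\<close>. More than
  \<open>U * (1 - 1 / m) ^ b = U - P\<close> would be left over, so the total size would be less than \<open>P\<close>.
  The speed of the fast machine is positive unless some bag has size at least \<open>U / m\<close>; in that
  case equal speeds \<open>U / m\<close> are bad enough.
\<close>

text \<open>Each collected bag multiplies the remainder \<open>U - sum a J\<close> by a factor above
  \<open>1 - 1 / r\<close>; \<open>r\<close> stands for the number of machines. Strictness takes at
  least one bag, since for none both sides equal \<open>U\<close>.\<close>

lemma remainder_lower_bound:
  fixes a :: "'a \<Rightarrow> real" and U r :: real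
  assumes "finite J" and r: "r \<ge> 1"
    and "\<And>j. j \<in> J \<Longrightarrow> a j \<ge> 0"
    and "\<And>j. j \<in> J \<Longrightarrow> (r - 1) * a j + (\<Sum>i | i \<in> J \<and> a j \<le> a i. a i) < U"
  shows "U * (1 - 1 / r) ^ card J \<le> U - sum a J
    \<and> (J \<noteq> {} \<longrightarrow> U * (1 - 1 / r) ^ card J < U - sum a J)"
  using assms(1,3,4)
\<comment> \<open>Ranking by \<open>- a\<close> adds the bags from the largest to the smallest, so
  \<open>x\<close> is a smallest bag of \<open>insert x S\<close>.\<close>
proof (induction J rule: finite_ranking_induct[where f = "\<lambda>j. - a j"])
  case empty
  show ?case by simp
next
  case (insert x S)
  show ?case
  proof (cases "x \<in> S")
    case True
    then show ?thesis using insert by (simp add: insert_absorb)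
  next
    case False
    have min: "a x \<le> a y" if "y \<in> S" for y
      using insert.hyps(2)[OF that] by simp
    have "(r - 1) * a j + (\<Sum>i | i \<in> S \<and> a j \<le> a i. a i) < U" if "j \<in> S" for j
    proof -
      \<comment> \<open>Leaving out \<open>x\<close> drops at most one nonnegative term, so the bags
        in \<open>S\<close> keep the hypothesis.\<close>
      have "(\<Sum>i | i \<in> S \<and> a j \<le> a i. a i) \<le> (\<Sum>i | i \<in> insert x S \<and> a j \<le> a i. a i)"
        using insert by (intro sum_mono2) auto
      then show ?thesis using insert.prems(2)[of j] that by simp
    qed
    then have IH: "U * (1 - 1 / r) ^ card S \<le> U - sum a S"
      using insert by auto
    have "{i \<in> insert x S. a x \<le> a i} = insert x S" using min by auto
    then have "(r - 1) * a x + sum a (insert x S) < U"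
      using insert.prems(2)[of x] by simp
    then have "r * a x < U - sum a S"
      using insert.hyps(1) False by (simp add: algebra_simps)
    then have "a x < (U - sum a S) / r" using r by (simp add: field_simps)
    then have "(U - sum a S) * (1 - 1 / r) < U - sum a (insert x S)"
      using insert.hyps(1) False by (simp add: algebra_simps diff_divide_distrib)
    moreover have "U * (1 - 1 / r) ^ card (insert x S) \<le> (U - sum a S) * (1 - 1 / r)"
      using mult_right_mono[OF IH, of "1 - 1 / r"] insert.hyps(1) False r
      by (simp add: mult_ac)
    ultimately show ?thesis by simp
  qed
qed

lemma rho_bar_eq:
  assumes "m > 0"
  shows "rho_bar m b = 1 / (1 - (1 - 1 / real m) ^ b)"
proof -
  have "(1 - 1 / real m) ^ b = (real m - 1) ^ b / real m ^ b"
    using assms by (simp add: diff_divide_distrib flip: power_divide)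
  then have "1 - (1 - 1 / real m) ^ b = (real m ^ b - (real m - 1) ^ b) / real m ^ b"
    using assms by (simp add: diff_divide_distrib)
  then show ?thesis by (simp add: rho_bar_def)
qed

text \<open>A bag in \<open>B\<close> certifies that machine \<open>i\<close> has nonzero speed;
  otherwise its completion time would be 0 by convention.\<close>

lemma makespan_ge_1:
  assumes f: "f \<in> assignments m b s" and s: "\<And>i. i \<in> {1..m} \<Longrightarrow> s i \<ge> 0"
    and a: "\<And>j. j \<in> {1..b} \<Longrightarrow> a j \<ge> 0"
    and B: "B \<subseteq> {1..b}" "B \<noteq> {}" "\<And>j. j \<in> B \<Longrightarrow> f j = i" and le: "s i \<le> sum a B"
  shows "makespan m b a s f \<ge> 1"
proof -
  obtain j where j: "j \<in> B" using B by blast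
  then have "f j \<in> {1..m}" "s (f j) \<noteq> 0"
    using f B(1) unfolding assignments_def by auto
  then have i: "i \<in> {1..m}" "s i > 0"
    using B(3)[OF j] s[of i] by auto
  have "sum a B \<le> (\<Sum>j | j \<in> {1..b} \<and> f j = i. a j)"
    using B a by (intro sum_mono2) auto
  then have "1 \<le> completion_time b a s f i"
    using i le by (simp add: completion_time_def)
  also have "\<dots> \<le> makespan m b a s f"
    unfolding makespan_def using i by (intro Max_ge) auto
  finally show ?thesis .
qed

lemma bad_speeds:
  assumes m: "m > 0" and b: "b > 0" and P: "P > 0" and a: "a \<in> bag_sizes b P"
  obtains s where "s \<in> speeds m"
    and "\<And>f. f \<in> assignments m b s \<Longrightarrow> makespan m b a s f \<ge> rho_bar m b * opt_makespan m P s"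
proof -
  define q where "q = (1 - 1 / real m) ^ b"
  define U where "U = rho_bar m b * P"
  have a0: "a j \<ge> 0" if "j \<in> {1..b}" for j
    using a that by (auto simp: bag_sizes_def)
  have sum: "sum a {1..b} = P" using a by (simp add: bag_sizes_def)
  have "q < 1"
    unfolding q_def using m b by (intro power_less_one_iff[THEN iffD2]) auto
  then have U: "U * (1 - q) = P" and U0: "U > 0"
    using P rho_bar_eq[OF m, of b] by (simp_all add: U_def q_def)
  have target: "rho_bar m b * opt_makespan m P s = 1" if "sum s {1..m} = U" for s
    using that U0 unfolding opt_makespan_def by (simp add: U_def[symmetric])
  show ?thesis
  proof (cases "\<exists>j\<in>{1..b}. U \<le> real m * a j")
    case True
    then obtain j where j: "j \<in> {1..b}" "U \<le> real m * a j" by blast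
    define s where "s = (\<lambda>_::nat. U / real m)"
    have s: "s \<in> speeds m" using U0 m by (auto simp: speeds_def s_def)
    have "makespan m b a s f \<ge> 1" if f: "f \<in> assignments m b s" for f
      using U0 m j a0
      by (intro makespan_ge_1[OF f, where B = "{j}" and i = "f j"]) (auto simp: s_def field_simps)
    with s show ?thesis
      using that target[of s] m by (simp add: s_def)
  next
    case False
    have "\<exists>k\<in>{1..b}. U \<le> (real m - 1) * a k + (\<Sum>i | i \<in> {1..b} \<and> a k \<le> a i. a i)"
    proof (rule ccontr)
      assume "\<not> ?thesis"
      \<comment> \<open>Strict because \<open>b > 0\<close>, whereas \<open>U * (1 - q) = P\<close>
        makes both sides equal.\<close>
      then have "U * q < U - P"
        using remainder_lower_bound[of "{1..b}" "real m" a U] m b a0 sum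
        by (auto simp: q_def not_le)
      with U show False by (simp add: algebra_simps)
    qed
    then obtain k where k: "k \<in> {1..b}"
      and crit: "U \<le> (real m - 1) * a k + (\<Sum>i | i \<in> {1..b} \<and> a k \<le> a i. a i)" by blast
    define s where "s = (\<lambda>i. if i = m then U - (real m - 1) * a k else a k)"
    have "real m * a k < U" using False k by (auto simp: not_le)
    then have sm: "s m > 0" using a0[OF k] by (simp add: s_def algebra_simps)
    have s0: "s i \<ge> 0" for i using sm a0[OF k] by (auto simp: s_def)
    have s: "s \<in> speeds m"
      unfolding speeds_def using s0 sm m by (auto intro!: bexI[of _ m])
    have "sum s {1..m} = s m + sum s {1..<m}"
      using m sum.last_plus[of 1 m s] by simp
    also have "sum s {1..<m} = (real m - 1) * a k"
      using m by (simp add: s_def of_nat_diff)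
    finally have sumU: "sum s {1..m} = U" by (simp add: s_def)
    have "makespan m b a s f \<ge> 1" if f: "f \<in> assignments m b s" for f
    proof (cases "\<exists>j\<in>{1..b}. a k \<le> a j \<and> f j \<noteq> m")
      case True
      then obtain j where "j \<in> {1..b}" "a k \<le> a j" "f j \<noteq> m" by blast
      \<comment> \<open>Bag \<open>j\<close> alone delays its slow machine. If
        \<open>a k = 0\<close>, slow machines have speed zero and admit no bag, so the case cannot
        occur.\<close>
      then show ?thesis
        using s0 a0 by (intro makespan_ge_1[OF f, where B = "{j}" and i = "f j"]) (auto simp: s_def)
    next
      case False
      then show ?thesis
        using s0 a0 k crit
        by (intro makespan_ge_1[OF f, where B = "{i \<in> {1..b}. a k \<le> a i}" and i = m])
          (auto simp: s_def)
    qed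
    with s show ?thesis using that target[OF sumU] by simp
  qed
qed

theorem theorem4:
  fixes m b :: nat
  assumes "m > 0" and "b > 0"
  shows "rho_bar m b = 1 / (1 - (1 - 1 / real m) ^ b)
    \<and> (\<forall>A. first_stage_algorithm A \<longrightarrow> \<not> robustness_factor A m b < rho_bar m b)
    \<and> (\<forall>P>0. \<forall>a\<in>bag_sizes b P. \<exists>s\<in>speeds m. \<forall>f\<in>assignments m b s.
         makespan m b a s f \<ge> rho_bar m b * opt_makespan m P s)"
proof (intro conjI allI impI ballI)
  show "rho_bar m b = 1 / (1 - (1 - 1 / real m) ^ b)"
    using assms(1) by (rule rho_bar_eq)
next
  fix A assume A: "first_stage_algorithm A"
  \<comment> \<open>\<open>robust\<close> demands the bound for every volume, so the single volume 1
    already refutes a smaller factor.\<close>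
  then have "A m b 1 \<in> bag_sizes b 1"
    using assms by (simp add: first_stage_algorithm_def)
  then obtain s where s: "s \<in> speeds m"
    and ge: "\<And>f. f \<in> assignments m b s \<Longrightarrow>
      makespan m b (A m b 1) s f \<ge> rho_bar m b * opt_makespan m 1 s"
    using bad_speeds[OF assms zero_less_one] by blast
  obtain f where f: "f \<in> assignments m b s"
    and le: "makespan m b (A m b 1) s f \<le> robustness_factor A m b * opt_makespan m 1 s"
    using robust_robustness_factor(1)[OF A assms] s unfolding robust_def by (meson zero_less_one)
  have "rho_bar m b * opt_makespan m 1 s \<le> robustness_factor A m b * opt_makespan m 1 s"
    using ge[OF f] le by linarith
  moreover have "opt_makespan m 1 s > 0"
    using sum_speeds_pos[OF s] by (simp add: opt_makespan_def)
  ultimately show "\<not> robustness_factor A m b < rho_bar m b"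
    by (simp add: not_less)
next
  fix P :: real and a assume "P > 0" "a \<in> bag_sizes b P"
  then show "\<exists>s\<in>speeds m. \<forall>f\<in>assignments m b s.
      makespan m b a s f \<ge> rho_bar m b * opt_makespan m P s"
    using bad_speeds[OF assms] by metis
qed

end
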